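(* Let $\alpha\in\mathbb R$ with $\alpha\neq-2$ and $\alpha\ne 0$, and consider the planar $n$-body problem with masses $m_1,\dots,m_n>0$ and the homogeneous potential of degree $\alpha$ $$U=-\beta\sum_{i>j}m_im_j|\mathbf r_i-\mathbf r_j|^{\alpha},\qquad \beta=1\text{ if }\alpha<0,\quad \beta=-1\text{ if }\alpha>0 .$$ Let $x(t)=(\mathbf r_1(t),\dots,\mathbf r_n(t))$ be a solution, defined on a time interval, which is collinear and has non-zero total angular momentum. Then $x(t)$ is a homographic motion with central configurations, i.e. $x(t)$ is homographic and, for every $t$, the configuration $x(t)$ is a central configuration. In particular, if in addition the moment of inertia $I=\sum_{i=1}^n m_i|\mathbf r_i|^2$ is constant along the solution, then $x(t)$ is a relative equilibrium.
   Context: Setting: $n$ bodies $P_1,\dots,P_n$ with masses $m_i>0$ move in the plane $\mathbb R^2$. Positions $\mathbf r_i=(x_i,y_i)$ are taken with respect to the center of mass, so $\sum_i m_i\mathbf r_i=0$. A solution is a twice differentiable collision-free curve ($\mathbf r_i(t)\ne\mathbf r_j(t)$ for all $i\neq j$ and all $t$) on an interval, satisfying $m_i\ddot{\mathbf r}_i=-\partial U/\partial\mathbf r_i$ for $i=1,\dots,n$. Collinear solution: at every time $t$ all bodies lie on a common line (which then passes through the center of mass), and this line may rotate in the plane about the center of mass. Total angular momentum: the quantity $K=\sum_{i=1}^n m_i(x_i\dot y_i-y_i\dot x_i)$, which is constant along solutions. Homographic solution: fixing an initial instant $t_0$ and writing $\mathbf r_i^0=\mathbf r_i(t_0)$, there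 exist for every $t$ a scalar $\nu(t)>0$ and an orthogonal $2\times2$ matrix $\Omega(t)$, both independent of $i$, such that $\mathbf r_i(t)=\nu(t)\Omega(t)\mathbf r_i^0$ for every $i$ and every $t$. Central configuration: a configuration $x=(\mathbf r_1,\dots,\mathbf r_n)\in\mathbb R^{2n}$ such that $\nabla U(x)=\omega^2\nabla I(x)$ for some real constant $\omega$, where $\nabla=(m_1^{-1}\nabla_1,\dots,m_n^{-1}\nabla_n)$, $\nabla_i$ is the gradient with respect to $\mathbf r_i$, and $I(x)=\sum_i m_i|\mathbf r_i|^2$. (The constant $\omega$ may depend on the configuration, hence on $t$ along a solution.) Relative equilibrium: a homographic solution with $\nu(t)=1$ for all $t$, i.e. $\mathbf r_i(t)=\Omega(t)\mathbf r_i^0$ for every $i$ and $t$ with $\Omega(t)$ orthogonal and independent of $i$; that is, the system rotates about the center of mass as a rigid body, with constant angular velocity and constant mutual distances. *)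

theory Defs
  imports "HOL-Analysis.Analysis"
begin

text \<open>
  The bodies are indexed by \<open>i < n\<close>; a configuration is a function \<open>nat \<Rightarrow> real^2\<close> of which only the
  values below \<open>n\<close> matter. A motion is a curve of configurations, considered on a set \<open>T\<close> of times.
  All time derivatives are taken within \<open>T\<close>, hence are one-sided at those endpoints of the interval
  \<open>T\<close> that belong to it.
\<close>

type_synonym configuration = "nat \<Rightarrow> real^2"

definition collision_free :: "nat \<Rightarrow> configuration \<Rightarrow> bool" where
  "collision_free n x \<longleftrightarrow> (\<forall>i<n. \<forall>j<n. i \<noteq> j \<longrightarrow> x i \<noteq> x j)"

definition potential :: "real \<Rightarrow> nat \<Rightarrow> (nat \<Rightarrow> real) \<Rightarrow> configuration \<Rightarrow> real" where
  "potential \<alpha> n m x =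
     - (if \<alpha> < 0 then 1 else - 1) * (\<Sum>i<n. \<Sum>j<i. m i * m j * norm (x i - x j) powr \<alpha>)"

definition moment_of_inertia :: "nat \<Rightarrow> (nat \<Rightarrow> real) \<Rightarrow> configuration \<Rightarrow> real" where
  "moment_of_inertia n m x = (\<Sum>i<n. m i * (norm (x i))\<^sup>2)"

text \<open>
  The gradient with respect to the position of body \<open>i\<close>; it is only meaningful where the gradient
  exists, which for \<open>potential\<close> is guaranteed at collision-free configurations.
\<close>

definition partial_gradient :: "(configuration \<Rightarrow> real) \<Rightarrow> nat \<Rightarrow> configuration \<Rightarrow> real^2" where
  "partial_gradient F i x = (THE D. GDERIV (\<lambda>q. F (x(i := q))) (x i) :> D)"

lemma partial_gradient_eqI:
  assumes "GDERIV (\<lambda>q. F (x(i := q))) (x i) :> D"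
  shows "partial_gradient F i x = D"
  unfolding partial_gradient_def
proof (rule the_equality)
  show "GDERIV (\<lambda>q. F (x(i := q))) (x i) :> D" by (fact assms)
next
  fix D' assume "GDERIV (\<lambda>q. F (x(i := q))) (x i) :> D'"
  with assms have "(\<lambda>h. inner h D') = (\<lambda>h. inner h D)"
    unfolding gderiv_def by (rule has_derivative_unique[rotated])
  then show "D' = D"
    by (metis inner_commute vector_eq_rdot)
qed

definition mass_gradient ::
    "(nat \<Rightarrow> real) \<Rightarrow> (configuration \<Rightarrow> real) \<Rightarrow> nat \<Rightarrow> configuration \<Rightarrow> real^2" where
  "mass_gradient m F i x = inverse (m i) *\<^sub>R partial_gradient F i x"

definition velocity :: "real set \<Rightarrow> (real \<Rightarrow> configuration) \<Rightarrow> nat \<Rightarrow> real \<Rightarrow> real^2" where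
  "velocity T x i t = vector_derivative (\<lambda>s. x s i) (at t within T)"

definition acceleration :: "real set \<Rightarrow> (real \<Rightarrow> configuration) \<Rightarrow> nat \<Rightarrow> real \<Rightarrow> real^2" where
  "acceleration T x i t = vector_derivative (velocity T x i) (at t within T)"

definition solution ::
    "real \<Rightarrow> nat \<Rightarrow> (nat \<Rightarrow> real) \<Rightarrow> real set \<Rightarrow> (real \<Rightarrow> configuration) \<Rightarrow> bool" where
  "solution \<alpha> n m T x \<longleftrightarrow>
     (\<forall>i<n. (\<lambda>s. x s i) differentiable_on T \<and> velocity T x i differentiable_on T) \<and>
     (\<forall>t\<in>T. collision_free n (x t)) \<and>
     (\<forall>t\<in>T. (\<Sum>i<n. m i *\<^sub>R x t i) = 0) \<and>
     (\<forall>t\<in>T. \<forall>i<n. m i *\<^sub>R acceleration T x i t = - partial_gradient (potential \<alpha> n m) i (x t))"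

definition collinear_motion :: "nat \<Rightarrow> real set \<Rightarrow> (real \<Rightarrow> configuration) \<Rightarrow> bool" where
  "collinear_motion n T x \<longleftrightarrow> (\<forall>t\<in>T. collinear (x t ` {..<n}))"

definition angular_momentum ::
    "nat \<Rightarrow> (nat \<Rightarrow> real) \<Rightarrow> real set \<Rightarrow> (real \<Rightarrow> configuration) \<Rightarrow> real \<Rightarrow> real" where
  "angular_momentum n m T x t =
     (\<Sum>i<n. m i * (x t i $ 1 * velocity T x i t $ 2 - x t i $ 2 * velocity T x i t $ 1))"

definition homographic_with ::
    "nat \<Rightarrow> real set \<Rightarrow> (real \<Rightarrow> configuration) \<Rightarrow> real \<Rightarrow> (real \<Rightarrow> real) \<Rightarrow> (real \<Rightarrow> real^2^2) \<Rightarrow> bool" where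
  "homographic_with n T x t0 \<nu> \<Omega> \<longleftrightarrow>
     (\<forall>t\<in>T. \<nu> t > 0 \<and> orthogonal_matrix (\<Omega> t) \<and> (\<forall>i<n. x t i = \<nu> t *\<^sub>R (\<Omega> t *v x t0 i)))"

definition homographic :: "nat \<Rightarrow> real set \<Rightarrow> (real \<Rightarrow> configuration) \<Rightarrow> bool" where
  "homographic n T x \<longleftrightarrow> (\<forall>t0\<in>T. \<exists>\<nu> \<Omega>. homographic_with n T x t0 \<nu> \<Omega>)"

definition central_configuration ::
    "real \<Rightarrow> nat \<Rightarrow> (nat \<Rightarrow> real) \<Rightarrow> configuration \<Rightarrow> bool" where
  "central_configuration \<alpha> n m x \<longleftrightarrow> collision_free n x \<and>
     (\<exists>\<omega>::real. \<forall>i<n. mass_gradient m (potential \<alpha> n m) i x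
                        = \<omega>\<^sup>2 *\<^sub>R mass_gradient m (moment_of_inertia n m) i x)"

definition rotation2 :: "real \<Rightarrow> real^2^2" where
  "rotation2 \<theta> = vector [vector [cos \<theta>, - sin \<theta>], vector [sin \<theta>, cos \<theta>]]"

text \<open>
  The second clause is the rigid rotation with one constant angular velocity \<open>w\<close>. It is stated
  separately because the matrices \<open>\<Omega> t\<close> of the first clause are not determined by the motion when
  the configuration is collinear. Constancy of the mutual distances follows from either clause.
\<close>

definition relative_equilibrium :: "nat \<Rightarrow> real set \<Rightarrow> (real \<Rightarrow> configuration) \<Rightarrow> bool" where
  "relative_equilibrium n T x \<longleftrightarrow>
     (\<forall>t0\<in>T. \<exists>\<Omega>. homographic_with n T x t0 (\<lambda>_. 1) \<Omega>) \<and>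
     (\<exists>w. \<forall>t0\<in>T. \<forall>t\<in>T. \<forall>i<n. x t i = rotation2 (w * (t - t0)) *v x t0 i)"

end

theory Submission
  imports Defs
begin

text \<open>
  All bodies lie on a line through the centre of mass, so every mutual force, hence every
  acceleration, is parallel to every position vector. Therefore each body conserves its own angular
  momentum \<open>c i\<close>, and some \<open>c k\<close> is non-zero, so that body \<open>k\<close> never meets the centre. Writing
  \<open>x i = a i *\<^sub>R x k\<close> and differentiating \<open>cross2 (x k) (x i) = 0\<close> gives \<open>(a i)\<^sup>2 = c i / c k\<close>; by
  continuity the ratios \<open>a i\<close> are constant. The acceleration of body \<open>k\<close> is a multiple of its position,
  and with constant ratios the same multiplier serves all bodies; its sign comes from the virial
  sum of the (attractive) forces. If the moment of inertia is constant, \<open>x k\<close> moves on a circle with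
  constant angular momentum, that is, uniformly.
\<close>

section \<open>The planar cross product as a test for parallel vectors\<close>

definition cross2 :: "real^2 \<Rightarrow> real^2 \<Rightarrow> real" where
  "cross2 u v = u $ 1 * v $ 2 - u $ 2 * v $ 1"

lemma bounded_bilinear_cross2: "bounded_bilinear cross2"
proof
  show "\<exists>K. \<forall>a b. norm (cross2 a b) \<le> norm a * norm b * K"
  proof (intro exI allI)
    fix a b :: "real^2"
    have "\<bar>a $ 1 * b $ 2\<bar> \<le> norm a * norm b" "\<bar>a $ 2 * b $ 1\<bar> \<le> norm a * norm b"
      by (auto simp: abs_mult intro!: mult_mono component_le_norm_cart)
    then show "norm (cross2 a b) \<le> norm a * norm b * 2"
      by (simp add: cross2_def)
  qed
qed (auto simp: cross2_def algebra_simps)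

interpretation cross2: bounded_bilinear cross2
  by (rule bounded_bilinear_cross2)

lemma cross2_self [simp]: "cross2 u u = 0"
  by (simp add: cross2_def)

lemma cross2_eq_0_imp:
  assumes "cross2 u v = 0" and "u \<noteq> 0"
  shows "v = ((v \<bullet> u) / (u \<bullet> u)) *\<^sub>R u"
proof -
  have nz: "u \<bullet> u \<noteq> 0"
    using assms(2) by simp
  \<comment> \<open>In coordinates the difference of the two sides is \<open>cross2 u v\<close>
    times the quarter turn of \<open>u\<close>.\<close>
  have "(u \<bullet> u) *\<^sub>R v = (v \<bullet> u) *\<^sub>R u"
    using assms(1)
    by (auto simp: vec_eq_iff forall_2 inner_vec_def sum_2 cross2_def) algebra+
  then have "(1 / (u \<bullet> u)) *\<^sub>R (u \<bullet> u) *\<^sub>R v = (1 / (u \<bullet> u)) *\<^sub>R (v \<bullet> u) *\<^sub>R u"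
    by simp
  then show ?thesis
    using nz by simp
qed

section \<open>Gradients of the potential and the moment of inertia; the virial sum\<close>

lemma GDERIV_sum:
  assumes "\<And>a. a \<in> A \<Longrightarrow> GDERIV (f a) x :> D a"
  shows "GDERIV (\<lambda>q. \<Sum>a\<in>A. f a q) x :> (\<Sum>a\<in>A. D a)"
  using assms unfolding gderiv_def inner_sum_right by (rule has_derivative_sum)

lemma GDERIV_cmult:
  assumes "GDERIV f x :> D"
  shows "GDERIV (\<lambda>q. c * f q) x :> c *\<^sub>R D"
  using assms unfolding gderiv_def
  by (auto intro!: derivative_eq_intros)

text \<open>Writing \<open>sgn x\<close> as \<open>x\<close> divided by its norm lowers the exponent
  from \<open>\<alpha> - 1\<close> to \<open>\<alpha> - 2\<close> and leaves a plain multiple of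
  \<open>x\<close>, so that pair forces become multiples of differences of positions.\<close>

lemma GDERIV_norm_powr:
  fixes x :: "'a::real_inner"
  assumes "x \<noteq> 0"
  shows "GDERIV (\<lambda>q. norm q powr \<alpha>) x :> (\<alpha> * norm x powr (\<alpha> - 2)) *\<^sub>R x"
proof -
  have "GDERIV (\<lambda>q. norm q powr \<alpha>) x :> (\<alpha> * norm x powr (\<alpha> - 1)) *\<^sub>R sgn x"
    by (intro GDERIV_DERIV_compose GDERIV_norm has_real_derivative_powr) (use assms in auto)
  moreover have "norm x powr (\<alpha> - 1) = norm x powr (\<alpha> - 2) * norm x"
    using assms powr_mult_base[of "norm x" "\<alpha> - 2"] by (simp add: mult.commute)
  ultimately show ?thesis
    using assms by (simp add: sgn_div_norm mult.assoc)
qed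

text \<open>Chain rule: the separation depends on the position of body \<open>i\<close> with factor
  1, -1 or 0. The indicator difference encodes the three cases at once, so sums over pairs are
  differentiated term by term without splitting.\<close>

lemma GDERIV_norm_diff_powr:
  fixes x :: configuration
  assumes "a \<noteq> b" and "x a \<noteq> x b"
  shows "GDERIV (\<lambda>q. norm ((x(i := q)) a - (x(i := q)) b) powr \<alpha>) (x i) :>
    (of_bool (a = i) - of_bool (b = i)) *\<^sub>R (\<alpha> * norm (x a - x b) powr (\<alpha> - 2)) *\<^sub>R (x a - x b)"
proof -
  let ?s = "of_bool (a = i) - of_bool (b = i) :: real"
  let ?g = "\<lambda>q. (x(i := q)) a - (x(i := q)) b"
  have g: "(?g has_derivative (\<lambda>h. ?s *\<^sub>R h)) (at (x i))"
    using assms(1) by (auto intro!: derivative_eq_intros)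
  have "((\<lambda>q. norm q powr \<alpha>) has_derivative
      (\<lambda>h. h \<bullet> ((\<alpha> * norm (x a - x b) powr (\<alpha> - 2)) *\<^sub>R (x a - x b)))) (at (?g (x i)))"
    using GDERIV_norm_powr[of "x a - x b" \<alpha>] assms(2) by (simp add: gderiv_def)
  from has_derivative_compose[OF g this] show ?thesis
    unfolding gderiv_def by (simp only: inner_scaleR_left inner_scaleR_right mult.left_commute)
qed

text \<open>The factor \<open>\<bar>\<alpha>\<bar>\<close> is \<open>\<alpha>\<close> times the sign
  in front of the potential, so for positive masses no pair repels. Keeping the sum over pairs, with
  indicators selecting body \<open>i\<close>, prepares the exchange of sums in
  \<open>virial_nonneg\<close>.\<close>

definition potential_gradient ::
    "real \<Rightarrow> nat \<Rightarrow> (nat \<Rightarrow> real) \<Rightarrow> configuration \<Rightarrow> nat \<Rightarrow> real^2" where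
  "potential_gradient \<alpha> n m x i =
     (\<Sum>a<n. \<Sum>b<a. (of_bool (a = i) - of_bool (b = i)) *\<^sub>R
        (\<bar>\<alpha>\<bar> * m a * m b * norm (x a - x b) powr (\<alpha> - 2)) *\<^sub>R (x a - x b))"

lemma partial_gradient_potential:
  assumes "collision_free n x"
  shows "partial_gradient (potential \<alpha> n m) i x = potential_gradient \<alpha> n m x i"
proof (rule partial_gradient_eqI)
  let ?\<beta> = "- (if \<alpha> < 0 then 1 else - 1 :: real)"
  have "GDERIV (\<lambda>q. potential \<alpha> n m (x(i := q))) (x i) :>
    ?\<beta> *\<^sub>R (\<Sum>a<n. \<Sum>b<a. (m a * m b) *\<^sub>R (of_bool (a = i) - of_bool (b = i)) *\<^sub>R
      (\<alpha> * norm (x a - x b) powr (\<alpha> - 2)) *\<^sub>R (x a - x b))"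
    unfolding potential_def
    by (intro GDERIV_cmult GDERIV_sum GDERIV_norm_diff_powr)
      (use assms in \<open>auto simp: collision_free_def\<close>)
  also have "?\<beta> *\<^sub>R (\<Sum>a<n. \<Sum>b<a. (m a * m b) *\<^sub>R (of_bool (a = i) - of_bool (b = i)) *\<^sub>R
      (\<alpha> * norm (x a - x b) powr (\<alpha> - 2)) *\<^sub>R (x a - x b)) = potential_gradient \<alpha> n m x i"
    unfolding potential_gradient_def scaleR_sum_right
    by (intro sum.cong refl) (auto simp: mult_ac)
  finally show "GDERIV (\<lambda>q. potential \<alpha> n m (x(i := q))) (x i) :> potential_gradient \<alpha> n m x i" .
qed

text \<open>With the sum over bodies moved innermost, the indicators leave \<open>x a - x b\<close>,
  and each pair contributes a non-negative weight times its squared distance. This later gives the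
  multiplier of a central configuration its sign.\<close>

lemma virial_nonneg:
  assumes "\<forall>i<n. m i \<ge> 0"
  shows "(\<Sum>i<n. x i \<bullet> potential_gradient \<alpha> n m x i) \<ge> 0"
proof -
  let ?w = "\<lambda>a b. \<bar>\<alpha>\<bar> * m a * m b * norm (x a - x b) powr (\<alpha> - 2)"
  have sel: "(\<Sum>i<n. (of_bool (a = i) - of_bool (b = i)) *\<^sub>R x i) = x a - x b"
    if "a < n" "b < n" for a b
    using that by (simp add: scaleR_diff_left sum_subtractf of_bool_def if_distrib[of "\<lambda>c. c *\<^sub>R _"] cong: if_cong)
  have "(\<Sum>i<n. x i \<bullet> potential_gradient \<alpha> n m x i) =
      (\<Sum>i<n. \<Sum>a<n. \<Sum>b<a. ((of_bool (a = i) - of_bool (b = i)) *\<^sub>R x i) \<bullet> (?w a b *\<^sub>R (x a - x b)))"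
    unfolding potential_gradient_def inner_sum_right by (intro sum.cong refl) simp
  also have "\<dots> = (\<Sum>a<n. \<Sum>b<a. \<Sum>i<n. ((of_bool (a = i) - of_bool (b = i)) *\<^sub>R x i) \<bullet> (?w a b *\<^sub>R (x a - x b)))"
    by (subst sum.swap) (rule sum.cong[OF refl], rule sum.swap)
  also have "\<dots> = (\<Sum>a<n. \<Sum>b<a. (x a - x b) \<bullet> (?w a b *\<^sub>R (x a - x b)))"
    unfolding inner_sum_left[symmetric] by (intro sum.cong refl) (simp add: sel)
  also have "\<dots> \<ge> 0"
    using assms by (intro sum_nonneg) auto
  finally show ?thesis .
qed

lemma mass_gradient_moment_of_inertia:
  assumes "i < n" and "m i \<noteq> 0"
  shows "mass_gradient m (moment_of_inertia n m) i x = 2 *\<^sub>R x i"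
proof -
  have "GDERIV (\<lambda>q. m a * (norm ((x(i := q)) a))\<^sup>2) (x i) :> m a *\<^sub>R (if a = i then 2 *\<^sub>R x i else 0)" for a
    by (intro GDERIV_cmult)
      (auto simp: gderiv_def power2_norm_eq_inner inner_commute intro!: derivative_eq_intros)
  then have "GDERIV (\<lambda>q. moment_of_inertia n m (x(i := q))) (x i) :>
      (\<Sum>a<n. m a *\<^sub>R (if a = i then 2 *\<^sub>R x i else 0))"
    unfolding moment_of_inertia_def by (rule GDERIV_sum)
  also have "(\<Sum>a<n. m a *\<^sub>R (if a = i then 2 *\<^sub>R x i else 0)) = m i *\<^sub>R 2 *\<^sub>R x i"
    using assms(1) by (simp add: if_distrib[of "\<lambda>v. _ *\<^sub>R v"] cong: if_cong)
  finally have "partial_gradient (moment_of_inertia n m) i x = m i *\<^sub>R 2 *\<^sub>R x i"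
    by (rule partial_gradient_eqI)
  then show ?thesis
    using assms(2) by (simp add: mass_gradient_def)
qed

section \<open>Collinear configurations centred at the origin and their forces\<close>

lemma collinear_centred_cross2:
  fixes x :: configuration
  assumes "collinear (x ` {..<n})" and "\<forall>i<n. m i > 0" and "(\<Sum>i<n. m i *\<^sub>R x i) = 0"
    and "i < n" and "j < n"
  shows "cross2 (x i) (x j) = 0"
proof -
  obtain u where u: "\<And>p q. p \<in> x ` {..<n} \<Longrightarrow> q \<in> x ` {..<n} \<Longrightarrow> \<exists>c. p - q = c *\<^sub>R u"
    using assms(1) unfolding collinear_def by blast
  define M where "M = (\<Sum>i<n. m i)"
  have M: "M > 0"
    unfolding M_def using assms(2,4) by (intro sum_pos) auto
  have "\<exists>c. x i = c *\<^sub>R u" if "i < n" for i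
  proof -
    have "\<forall>j\<in>{..<n}. \<exists>c. x i - x j = c *\<^sub>R u"
      using u that by auto
    then obtain c where c: "\<And>j. j < n \<Longrightarrow> x i - x j = c j *\<^sub>R u"
      by (metis lessThan_iff)
    \<comment> \<open>Since the centre of mass is 0, each position is a weighted mean of differences
      of positions, all of which are multiples of \<open>u\<close>. Hence the common line passes
      through the origin.\<close>
    have "M *\<^sub>R x i = (\<Sum>j<n. m j *\<^sub>R (x i - x j))"
      using assms(3) by (simp add: M_def scaleR_diff_right sum_subtractf scaleR_left.sum)
    also have "\<dots> = (\<Sum>j<n. m j * c j) *\<^sub>R u"
      by (simp add: c scaleR_left.sum)
    finally have "(1 / M) *\<^sub>R M *\<^sub>R x i = ((1 / M) * (\<Sum>j<n. m j * c j)) *\<^sub>R u"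
      by simp
    then show ?thesis
      using M by auto
  qed
  then obtain c d where "x i = c *\<^sub>R u" "x j = d *\<^sub>R u"
    using assms(4,5) by blast
  then show ?thesis
    by (simp add: cross2.scaleR_left cross2.scaleR_right)
qed

lemma cross2_potential_gradient:
  assumes "\<And>j. j < n \<Longrightarrow> cross2 u (x j) = 0"
  shows "cross2 u (potential_gradient \<alpha> n m x i) = 0"
  unfolding potential_gradient_def cross2.sum_right
  using assms by (intro sum.neutral ballI) (simp add: cross2.scaleR_right cross2.diff_right)

section \<open>Orthogonal matrices and uniform circular motion\<close>

lemma rotation2_mult_vec:
  "rotation2 \<theta> *v u = vector [cos \<theta> * u $ 1 - sin \<theta> * u $ 2, sin \<theta> * u $ 1 + cos \<theta> * u $ 2]"
  by (simp add: vec_eq_iff forall_2 rotation2_def matrix_vector_mult_def sum_2)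

lemma orthogonal_matrix_rotation2: "orthogonal_matrix (rotation2 \<theta>)"
proof -
  have "cos \<theta> * cos \<theta> + sin \<theta> * sin \<theta> = 1"
    using sin_cos_squared_add3 by blast
  then show ?thesis
    by (simp add: orthogonal_matrix rotation2_def matrix_matrix_mult_def transpose_def mat_def
        vec_eq_iff forall_2 sum_2 algebra_simps)
qed

text \<open>Orthogonal maps act transitively on spheres; this supplies the matrices of a homographic
  motion, one time at a time.\<close>

lemma orthogonal_matrix_exists:
  fixes u v :: "real^'n"
  assumes "norm u = norm v"
  shows "\<exists>A. orthogonal_matrix A \<and> A *v u = v"
proof -
  obtain f where f: "orthogonal_transformation f" "f u = v"
    using orthogonal_transformation_exists[OF assms] .
  then have "orthogonal_matrix (matrix f)" "matrix f *v u = v"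
    by (simp_all add: orthogonal_transformation_matrix matrix_works)
  then show ?thesis
    by blast
qed

text \<open>The hypotheses force the velocity to be \<open>c / R\<close> times the quarter turn of
  \<open>y\<close>. Turning \<open>y\<close> back through the angle \<open>c / R * (t - t0)\<close>
  then yields a constant vector.\<close>

lemma uniform_rotation:
  fixes y v :: "real \<Rightarrow> real^2"
  assumes "convex T"
    and deriv: "\<And>t. t \<in> T \<Longrightarrow> (y has_vector_derivative v t) (at t within T)"
    and norm: "\<And>t. t \<in> T \<Longrightarrow> y t \<bullet> y t = R" "R \<noteq> 0"
    and orth: "\<And>t. t \<in> T \<Longrightarrow> y t \<bullet> v t = 0"
    and cross: "\<And>t. t \<in> T \<Longrightarrow> cross2 (y t) (v t) = c"
    and "t0 \<in> T" "t \<in> T"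
  shows "y t = rotation2 (c / R * (t - t0)) *v y t0"
proof -
  define w where "w = c / R"
  have wR: "w * R = c"
    using norm(2) by (simp add: w_def)
  have v1: "v t $ 1 = - w * y t $ 2" and v2: "v t $ 2 = w * y t $ 1" if "t \<in> T" for t
  proof -
    have eqs: "R = y t $ 1 * y t $ 1 + y t $ 2 * y t $ 2" "0 = y t $ 1 * v t $ 1 + y t $ 2 * v t $ 2"
      "w * R = y t $ 1 * v t $ 2 - y t $ 2 * v t $ 1"
      using norm(1)[OF that] orth[OF that] cross[OF that] wR by (auto simp: inner_vec_def sum_2 cross2_def)
    \<comment> \<open>Cramer's rule for the two linear equations in the coordinates of
      \<open>v t\<close>; their determinant is \<open>R\<close>.\<close>
    have "R * v t $ 1 = y t $ 1 * 0 - y t $ 2 * (w * R)" "R * v t $ 2 = y t $ 2 * 0 + y t $ 1 * (w * R)"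
      unfolding eqs(2,3) unfolding eqs(1) by (simp_all add: algebra_simps)
    then have "R * v t $ 1 = R * (- w * y t $ 2)" "R * v t $ 2 = R * (w * y t $ 1)"
      by (simp_all add: mult_ac)
    then show "v t $ 1 = - w * y t $ 2" "v t $ 2 = w * y t $ 1"
      by (simp_all only: mult_left_cancel[OF norm(2)])
  qed
  have d1: "((\<lambda>t. y t $ 1) has_real_derivative - w * y t $ 2) (at t within T)"
    and d2: "((\<lambda>t. y t $ 2) has_real_derivative w * y t $ 1) (at t within T)" if "t \<in> T" for t
    using bounded_linear.has_vector_derivative[OF bounded_linear_vec_nth deriv[OF that]]
    unfolding has_real_derivative_iff_has_vector_derivative by (simp_all only: v1[OF that, symmetric] v2[OF that, symmetric])
  let ?\<phi> = "\<lambda>t. w * (t - t0)"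
  \<comment> \<open>This and the next expression are the coordinates of \<open>y t\<close> turned
    back by \<open>?\<phi> t\<close>. As \<open>?\<phi> t0 = 0\<close>, the constants are the
    coordinates of \<open>y t0\<close>.\<close>
  have "\<exists>k. \<forall>t\<in>T. cos (?\<phi> t) * y t $ 1 + sin (?\<phi> t) * y t $ 2 = k"
    by (intro has_field_derivative_zero_constant \<open>convex T\<close>)
      (auto intro!: derivative_eq_intros d1 d2 simp: algebra_simps)
  moreover have "\<exists>k. \<forall>t\<in>T. cos (?\<phi> t) * y t $ 2 - sin (?\<phi> t) * y t $ 1 = k"
    by (intro has_field_derivative_zero_constant \<open>convex T\<close>)
      (auto intro!: derivative_eq_intros d1 d2 simp: algebra_simps)
  ultimately have *: "cos (?\<phi> t) * y t $ 1 + sin (?\<phi> t) * y t $ 2 = y t0 $ 1"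
    "cos (?\<phi> t) * y t $ 2 - sin (?\<phi> t) * y t $ 1 = y t0 $ 2"
    using \<open>t0 \<in> T\<close> \<open>t \<in> T\<close> by fastforce+
  define C S where "C = cos (?\<phi> t)" and "S = sin (?\<phi> t)"
  have unit: "C * C + S * S = 1"
    unfolding C_def S_def by (rule sin_cos_squared_add3)
  have "C * y t0 $ 1 - S * y t0 $ 2 = (C * C + S * S) * y t $ 1"
    "S * y t0 $ 1 + C * y t0 $ 2 = (C * C + S * S) * y t $ 2"
    unfolding *[symmetric] C_def[symmetric] S_def[symmetric] by (simp_all add: algebra_simps)
  then have "y t $ 1 = cos (?\<phi> t) * y t0 $ 1 - sin (?\<phi> t) * y t0 $ 2"
    "y t $ 2 = sin (?\<phi> t) * y t0 $ 1 + cos (?\<phi> t) * y t0 $ 2"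
    unfolding unit by (simp_all add: C_def S_def)
  then show ?thesis
    by (simp add: rotation2_mult_vec vec_eq_iff forall_2 w_def)
qed

section \<open>Collinear motions with non-zero angular momentum\<close>

theorem theorem2:
  fixes \<alpha> :: real and n :: nat and m :: "nat \<Rightarrow> real"
    and T :: "real set" and x :: "real \<Rightarrow> configuration"
  assumes "\<alpha> \<noteq> - 2" and "\<alpha> \<noteq> 0"
    and "\<forall>i<n. m i > 0"
    and "is_interval T" and "interior T \<noteq> {}"
    and "solution \<alpha> n m T x"
    and "collinear_motion n T x"
    and "\<exists>t\<in>T. angular_momentum n m T x t \<noteq> 0"
  shows "homographic n T x \<and>
         (\<forall>t\<in>T. central_configuration \<alpha> n m (x t)) \<and>
         ((\<exists>c. \<forall>t\<in>T. moment_of_inertia n m (x t) = c) \<longrightarrow> relative_equilibrium n T x)"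
proof -
  note mpos = \<open>\<forall>i<n. m i > 0\<close>
  define v where "v = velocity T x"
  define acc where "acc = acceleration T x"
  have conv: "convex T"
    using \<open>is_interval T\<close> by (rule is_interval_convex)
  have Dx: "((\<lambda>s. x s i) has_vector_derivative v i t) (at t within T)"
    and Dv: "(v i has_vector_derivative acc i t) (at t within T)" if "i < n" "t \<in> T" for i t
    using \<open>solution \<alpha> n m T x\<close> that
    by (auto simp: solution_def v_def acc_def velocity_def[abs_def] acceleration_def
        differentiable_on_def vector_derivative_works)
  have free: "collision_free n (x t)" and com: "(\<Sum>i<n. m i *\<^sub>R x t i) = 0" if "t \<in> T" for t
    using \<open>solution \<alpha> n m T x\<close> that by (auto simp: solution_def)
  have newton: "m i *\<^sub>R acc i t = - potential_gradient \<alpha> n m (x t) i" if "i < n" "t \<in> T" for i t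
    using \<open>solution \<alpha> n m T x\<close> that free
    by (auto simp: solution_def acc_def partial_gradient_potential)
  have par: "cross2 (x t i) (x t j) = 0" if "i < n" "j < n" "t \<in> T" for i j t
    using \<open>collinear_motion n T x\<close> mpos com that
    by (intro collinear_centred_cross2[of "x t" n m]) (auto simp: collinear_motion_def)
  have par_acc: "cross2 (x t i) (acc j t) = 0" if "i < n" "j < n" "t \<in> T" for i j t
  proof -
    have "m j * cross2 (x t i) (acc j t) = cross2 (x t i) (m j *\<^sub>R acc j t)"
      by (simp add: cross2.scaleR_right)
    also have "\<dots> = 0"
      using that by (simp add: newton cross2.minus_right cross2_potential_gradient par)
    finally show ?thesis
      using mpos that by auto
  qed
  have "\<exists>c. \<forall>t\<in>T. cross2 (x t i) (v i t) = c" if "i < n" for i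
  proof -
    \<comment> \<open>The product rule leaves \<open>cross2\<close> of position and acceleration,
      zero by \<open>par_acc\<close>, and \<open>cross2\<close> of the velocity with itself.\<close>
    have "((\<lambda>t. cross2 (x t i) (v i t)) has_vector_derivative 0) (at t within T)" if "t \<in> T" for t
      using cross2.has_vector_derivative[OF Dx Dv, OF \<open>i < n\<close> that \<open>i < n\<close> that] that \<open>i < n\<close>
      by (simp add: par_acc)
    then obtain c where "cross2 (x t i) (v i t) = c" if "t \<in> T" for t
      using has_vector_derivative_zero_constant[OF conv] by blast
    then show ?thesis
      by blast
  qed
  then obtain c where c: "\<And>i t. i < n \<Longrightarrow> t \<in> T \<Longrightarrow> cross2 (x t i) (v i t) = c i"
    by metis
  obtain t1 where t1: "t1 \<in> T" "angular_momentum n m T x t1 \<noteq> 0"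
    using assms(8) by blast
  have "angular_momentum n m T x t1 = (\<Sum>i<n. m i * c i)"
    unfolding angular_momentum_def
    by (intro sum.cong refl) (use c t1(1) in \<open>simp add: cross2_def v_def\<close>)
  with t1(2) have "(\<Sum>i<n. m i * c i) \<noteq> 0"
    by simp
  then obtain k where "k < n" "c k \<noteq> 0"
    by (metis (no_types, lifting) lessThan_iff mult_zero_right sum.neutral)
  have xk: "x t k \<noteq> 0" if "t \<in> T" for t
    using c[OF \<open>k < n\<close> that] \<open>c k \<noteq> 0\<close> by (auto simp: cross2.zero_left)
  \<comment> \<open>A connected set with more than one point has only limit points, which makes
    derivatives within \<open>T\<close> unique, endpoints included.\<close>
  have "T \<noteq> {t}" for t
    using \<open>interior T \<noteq> {}\<close> by auto
  then have unique: "f' = f''"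
    if "t \<in> T" "(f has_vector_derivative f') (at t within T)"
      "(f has_vector_derivative f'') (at t within T)"
    for f :: "real \<Rightarrow> 'a::real_normed_vector" and f' f'' t
    using that vector_derivative_unique_within connected_imp_perfect[of T t] convex_connected[OF conv]
    by (metis trivial_limit_within)

  \<comment> \<open>Constancy of the ratios of the positions\<close>
  have "\<exists>a. \<forall>t\<in>T. x t i = a *\<^sub>R x t k" if "i < n" for i
  proof -
    define a where "a t = (x t i \<bullet> x t k) / (x t k \<bullet> x t k)" for t
    have xi: "x t i = a t *\<^sub>R x t k" if "t \<in> T" for t
      using cross2_eq_0_imp[of "x t k" "x t i"] par xk that \<open>k < n\<close> \<open>i < n\<close> by (simp add: a_def)
    have sq: "(a t)\<^sup>2 = c i / c k" if "t \<in> T" for t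
    proof -
      \<comment> \<open>Differentiating the collinearity relation gives
        \<open>cross2 (x t k) (v i t) = a t * c k\<close>; multiplying by \<open>a t\<close> turns
        the left side into \<open>c i\<close>. The ratio is substituted pointwise and never
        differentiated.\<close>
      have "((\<lambda>t. cross2 (x t k) (x t i)) has_vector_derivative
          cross2 (x t k) (v i t) + cross2 (v k t) (x t i)) (at t within T)"
        using that \<open>k < n\<close> \<open>i < n\<close> by (intro cross2.has_vector_derivative Dx)
      moreover have "((\<lambda>t. cross2 (x t k) (x t i)) has_vector_derivative 0) (at t within T)"
        by (rule has_vector_derivative_transform[OF that _ has_vector_derivative_const])
          (use par \<open>k < n\<close> \<open>i < n\<close> in auto)
      ultimately have "cross2 (x t k) (v i t) + cross2 (v k t) (x t i) = 0"
        using that unique by blast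
      moreover have "cross2 (v k t) (x t i) = - a t * c k"
        using c[OF \<open>k < n\<close> that] by (simp add: xi[OF that] cross2_def algebra_simps)
      moreover have "c i = a t * cross2 (x t k) (v i t)"
        using c[OF \<open>i < n\<close> that] by (simp add: xi[OF that] cross2.scaleR_left)
      ultimately show ?thesis
        using \<open>c k \<noteq> 0\<close> by (simp add: power2_eq_square)
    qed
    have contx: "continuous_on T (\<lambda>t. x t j)" if "j < n" for j
      using Dx[OF that] continuous_on_vector_derivative by blast
    have "continuous_on T a"
      unfolding a_def[abs_def] using \<open>i < n\<close> \<open>k < n\<close> xk
      by (intro continuous_intros contx) auto
    then have "connected (a ` T)"
      using convex_connected[OF conv] by (rule connected_continuous_image)
    \<comment> \<open>At most two values are possible, and a finite connected image has at most one
      point. The value 0 covers a body resting at the centre of mass.\<close>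
    moreover have "a ` T \<subseteq> {sqrt (c i / c k), - sqrt (c i / c k)}"
      by (auto simp: real_sqrt_abs abs_if dest!: sq[symmetric])
    then have "finite (a ` T)"
      by (rule finite_subset) simp
    ultimately show ?thesis
      using xi by (metis connected_finite_iff_sing empty_iff imageI singletonD)
  qed
  then obtain a where a: "\<And>i t. i < n \<Longrightarrow> t \<in> T \<Longrightarrow> x t i = a i *\<^sub>R x t k"
    by metis

  \<comment> \<open>Homographic motion\<close>
  have "homographic n T x"
    unfolding homographic_def
  proof
    fix t0 assume "t0 \<in> T"
    \<comment> \<open>Body \<open>k\<close> alone determines the scale and the matrix. By linearity
      both carry over to the other bodies, which are fixed multiples of it.\<close>
    define \<nu> where "\<nu> t = norm (x t k) / norm (x t0 k)" for t
    have "\<exists>A. orthogonal_matrix A \<and> A *v (\<nu> t *\<^sub>R x t0 k) = x t k" if "t \<in> T" for t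
      using xk[OF \<open>t0 \<in> T\<close>] by (intro orthogonal_matrix_exists) (simp add: \<nu>_def)
    then have "\<forall>t\<in>T. \<exists>A. orthogonal_matrix A \<and> A *v (\<nu> t *\<^sub>R x t0 k) = x t k"
      by blast
    from bchoice[OF this] obtain \<Omega>
      where \<Omega>: "\<And>t. t \<in> T \<Longrightarrow> orthogonal_matrix (\<Omega> t)"
        "\<And>t. t \<in> T \<Longrightarrow> \<Omega> t *v (\<nu> t *\<^sub>R x t0 k) = x t k"
      by blast
    have "homographic_with n T x t0 \<nu> \<Omega>"
      unfolding homographic_with_def
    proof (intro ballI conjI allI impI)
      fix t i assume t: "t \<in> T" and i: "i < n"
      have "x t i = a i *\<^sub>R (\<Omega> t *v (\<nu> t *\<^sub>R x t0 k))"
        by (simp only: a[OF i t] \<Omega>(2)[OF t])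
      also have "\<dots> = \<nu> t *\<^sub>R (\<Omega> t *v x t0 i)"
        by (simp add: a[OF i \<open>t0 \<in> T\<close>] matrix_vector_mult_scaleR mult.commute)
      finally show "x t i = \<nu> t *\<^sub>R (\<Omega> t *v x t0 i)" .
    qed (use xk \<open>t0 \<in> T\<close> \<Omega> in \<open>auto simp: \<nu>_def\<close>)
    then show "\<exists>\<nu> \<Omega>. homographic_with n T x t0 \<nu> \<Omega>"
      by blast
  qed

  \<comment> \<open>Central configurations\<close>
  moreover have "central_configuration \<alpha> n m (x t)" if t: "t \<in> T" for t
  proof -
    \<comment> \<open>Proportionality passes to the accelerations by differentiating twice; the
      velocity relation is therefore proved on all of \<open>T\<close>, not only at
      \<open>t\<close>.\<close>
    have va: "v i s = a i *\<^sub>R v k s" if "i < n" "s \<in> T" for i s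
    proof (rule unique[OF \<open>s \<in> T\<close> Dx[OF that]])
      show "((\<lambda>s. x s i) has_vector_derivative a i *\<^sub>R v k s) (at s within T)"
        by (rule has_vector_derivative_transform[OF \<open>s \<in> T\<close> a[OF \<open>i < n\<close>]])
          (auto intro!: derivative_eq_intros Dx \<open>k < n\<close> \<open>s \<in> T\<close>)
    qed
    have acca: "acc i t = a i *\<^sub>R acc k t" if "i < n" for i
    proof (rule unique[OF t Dv[OF that t]])
      show "(v i has_vector_derivative a i *\<^sub>R acc k t) (at t within T)"
        by (rule has_vector_derivative_transform[OF t va[OF \<open>i < n\<close>]])
          (auto intro!: derivative_eq_intros Dv \<open>k < n\<close> t)
    qed
    \<comment> \<open>Up to sign, \<open>l\<close> is the coefficient of the acceleration of body
      \<open>k\<close> along its position. The sign is chosen so that \<open>l\<close> is the factor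
      in the potential gradient, expected non-negative under attraction.\<close>
    define l where "l = - (acc k t \<bullet> x t k) / (x t k \<bullet> x t k)"
    have "acc k t = - l *\<^sub>R x t k"
      using cross2_eq_0_imp[OF par_acc xk] \<open>k < n\<close> t by (simp add: l_def)
    then have acc: "acc i t = - l *\<^sub>R x t i" if "i < n" for i
      by (simp add: acca[OF that] a[OF that t])
    have grad: "potential_gradient \<alpha> n m (x t) i = (l * m i) *\<^sub>R x t i" if "i < n" for i
      using newton[OF that t] by (simp add: acc[OF that] mult.commute)
    \<comment> \<open>The virial sum equals \<open>l\<close> times the moment of inertia, which is
      positive because body \<open>k\<close> is away from the origin.\<close>
    have "0 \<le> (\<Sum>i<n. x t i \<bullet> potential_gradient \<alpha> n m (x t) i)"
      using mpos by (intro virial_nonneg) (auto intro: less_imp_le)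
    also have "\<dots> = l * (\<Sum>i<n. m i * (x t i \<bullet> x t i))"
      by (simp add: grad sum_distrib_left mult.assoc)
    finally have "0 \<le> l * (\<Sum>i<n. m i * (x t i \<bullet> x t i))" .
    moreover have "(\<Sum>i<n. m i * (x t i \<bullet> x t i)) > 0"
      using mpos \<open>k < n\<close> xk[OF t] by (intro sum_pos2[of _ k]) (auto intro: less_imp_le)
    ultimately have "l \<ge> 0"
      by (simp add: zero_le_mult_iff)
    \<comment> \<open>The two mass gradients are \<open>l\<close> and 2 times the position, so
      \<open>\<omega>\<close> squared must be \<open>l / 2\<close>; the square root is legitimate
      because \<open>l \<ge> 0\<close>.\<close>
    have "mass_gradient m (potential \<alpha> n m) i (x t)
        = (sqrt (l / 2))\<^sup>2 *\<^sub>R mass_gradient m (moment_of_inertia n m) i (x t)" if "i < n" for i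
    proof -
      have "m i \<noteq> 0"
        using mpos that by auto
      then show ?thesis
        using that t \<open>l \<ge> 0\<close>
        by (simp add: mass_gradient_moment_of_inertia mass_gradient_def[of _ "potential \<alpha> n m"]
            partial_gradient_potential free grad)
    qed
    then show ?thesis
      using free[OF t] by (auto simp: central_configuration_def)
  qed

  \<comment> \<open>Constant moment of inertia\<close>
  moreover have "relative_equilibrium n T x" if const: "\<exists>I. \<forall>t\<in>T. moment_of_inertia n m (x t) = I"
  proof -
    \<comment> \<open>With constant ratios the moment of inertia is \<open>A\<close> times the
      squared distance of body \<open>k\<close>. As \<open>a k = 1\<close> makes \<open>A\<close>
      positive, constancy of the former puts body \<open>k\<close> on a circle.\<close>
    define A where "A = (\<Sum>i<n. m i * (a i)\<^sup>2)"
    have mom: "moment_of_inertia n m (x t) = A * (x t k \<bullet> x t k)" if "t \<in> T" for t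
      unfolding moment_of_inertia_def A_def sum_distrib_right
      by (intro sum.cong refl) (simp add: a[OF _ that] power2_norm_eq_inner mult_ac power2_eq_square[of "a _"] del: norm_scaleR)
    have "a k = 1"
      using a[OF \<open>k < n\<close> t1(1)] xk[OF t1(1)] by (metis scaleR_cancel_right scaleR_one)
    then have "A > 0"
      unfolding A_def using mpos \<open>k < n\<close> by (intro sum_pos2[of _ k]) (auto intro: less_imp_le)
    obtain R where R: "\<And>t. t \<in> T \<Longrightarrow> x t k \<bullet> x t k = R"
      using const mom \<open>A > 0\<close> by (metis less_irrefl nonzero_mult_div_cancel_left)
    have "R \<noteq> 0"
      using R[OF t1(1)] xk[OF t1(1)] by auto
    have orth: "x t k \<bullet> v k t = 0" if "t \<in> T" for t
    proof -
      have "((\<lambda>t. x t k \<bullet> x t k) has_vector_derivative x t k \<bullet> v k t + v k t \<bullet> x t k) (at t within T)"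
        using that \<open>k < n\<close> by (intro bounded_bilinear.has_vector_derivative[OF bounded_bilinear_inner] Dx)
      moreover have "((\<lambda>t. x t k \<bullet> x t k) has_vector_derivative 0) (at t within T)"
        by (rule has_vector_derivative_transform[OF that R has_vector_derivative_const])
      ultimately have "x t k \<bullet> v k t + v k t \<bullet> x t k = 0"
        using that unique by blast
      then show ?thesis
        by (simp add: inner_commute)
    qed
    \<comment> \<open>The angular velocity is the angular momentum of body \<open>k\<close> per unit
      mass over its squared radius. It depends neither on \<open>t0\<close> nor on the body, as the
      clause on rigid rotation demands.\<close>
    define w where "w = c k / R"
    have rot: "x t i = rotation2 (w * (t - t0)) *v x t0 i" if "t0 \<in> T" "t \<in> T" "i < n" for t0 t i
      using uniform_rotation[OF conv Dx[OF \<open>k < n\<close>] R \<open>R \<noteq> 0\<close> orth c[OF \<open>k < n\<close>] that(1,2)]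
      by (simp add: a[OF that(3,1)] a[OF that(3,2)] w_def matrix_vector_mult_scaleR)
    have "homographic_with n T x t0 (\<lambda>_. 1) (\<lambda>t. rotation2 (w * (t - t0)))" if "t0 \<in> T" for t0
      unfolding homographic_with_def scaleR_one
      by (intro ballI conjI allI impI rot that orthogonal_matrix_rotation2 zero_less_one)
    with rot show ?thesis
      unfolding relative_equilibrium_def by blast
  qed
  ultimately show ?thesis
    by blast
qed

end
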